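(* There exists $\mathcal{M}\ne\{0\}$ in $\operatorname{Lat}(\mathfrak{L}_n)$ for which the associated left ideal $$i(\mathcal{M})=\{J\in\mathfrak{L}_n: J\xi_1\in\mathcal{M}\}$$ is trivial, i.e. $i(\mathcal{M})=\{0\}$.
   Context: Let $n$ be a finite positive integer. Let $\mathcal{F}_n$ be the unital free semigroup on $n$ generators $z_1,\dots,z_n$ (its unit is the empty word $1$), and let $\mathcal{H}_n=\ell_2(\mathcal{F}_n)$, with orthonormal basis $\{\xi_w: w\in\mathcal{F}_n\}$; in particular $\xi_1$ is the basis vector of the empty word. Let $L_i$ be the isometry on $\mathcal{H}_n$ with $L_i\xi_v=\xi_{z_iv}$. The non-commutative analytic Toeplitz algebra $\mathfrak{L}_n$ is the unital algebra, closed in the weak operator topology, generated by $L_1,\dots,L_n$ in $\mathcal{B}(\mathcal{H}_n)$. $\operatorname{Lat}(\mathfrak{L}_n)$ is the lattice of closed subspaces of $\mathcal{H}_n$ invariant under every operator in $\mathfrak{L}_n$.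
   Formalization: The formal theorem assumes n ≥ 2; for n = 1 the claim is false, since by Beurling every nonzero M in Lat is θH² with θ inner, and the analytic Toeplitz operator of θ is a nonzero element of i(M). *)

theory Defs
  imports "HOL-Analysis.Analysis"
begin

section \<open>The complex Hilbert space of square-summable families\<close>

typedef 'i ell2 = "{x :: 'i \<Rightarrow> complex. (\<lambda>i. (cmod (x i))\<^sup>2) summable_on UNIV}"
  morphisms coord Abs_ell2
  by (rule exI[of _ "\<lambda>_. 0"]) simp

setup_lifting type_definition_ell2

lemma ell2_mult_summable:
  fixes x y :: "'i \<Rightarrow> complex"
  assumes "(\<lambda>i. (cmod (x i))\<^sup>2) summable_on UNIV" "(\<lambda>i. (cmod (y i))\<^sup>2) summable_on UNIV"
  shows "(\<lambda>i. x i * cnj (y i)) summable_on UNIV"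
proof -
  have s: "(\<lambda>i. (cmod (x i))\<^sup>2 + (cmod (y i))\<^sup>2) summable_on UNIV"
    by (intro summable_on_add assms)
  have "(\<lambda>i. cmod (x i * cnj (y i))) summable_on UNIV"
  proof (rule summable_on_comparison_test[OF s])
    fix i
    have "0 \<le> (cmod (x i) - cmod (y i))\<^sup>2" by simp
    then have "2 * (cmod (x i) * cmod (y i)) \<le> (cmod (x i))\<^sup>2 + (cmod (y i))\<^sup>2"
      by (simp add: power2_diff)
    moreover have "0 \<le> cmod (x i) * cmod (y i)" by simp
    ultimately have "cmod (x i) * cmod (y i) \<le> (cmod (x i))\<^sup>2 + (cmod (y i))\<^sup>2"
      by linarith
    then show "cmod (x i * cnj (y i)) \<le> (cmod (x i))\<^sup>2 + (cmod (y i))\<^sup>2"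
      by (simp add: norm_mult)
  qed auto
  then show ?thesis
    by (rule abs_summable_summable)
qed

lemma ell2_add_summable:
  fixes x y :: "'i \<Rightarrow> complex"
  assumes "(\<lambda>i. (cmod (x i))\<^sup>2) summable_on UNIV" "(\<lambda>i. (cmod (y i))\<^sup>2) summable_on UNIV"
  shows "(\<lambda>i. (cmod (x i + y i))\<^sup>2) summable_on UNIV"
proof -
  have s: "(\<lambda>i. 2 * (cmod (x i))\<^sup>2 + 2 * (cmod (y i))\<^sup>2) summable_on UNIV"
    by (intro summable_on_add summable_on_cmult_right assms)
  show ?thesis
  proof (rule summable_on_comparison_test[OF s])
    fix i
    have "(cmod (x i + y i))\<^sup>2 \<le> (cmod (x i) + cmod (y i))\<^sup>2"
      by (intro power_mono norm_triangle_ineq) simp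
    also have "\<dots> \<le> 2 * (cmod (x i))\<^sup>2 + 2 * (cmod (y i))\<^sup>2"
      using zero_le_power2[of "cmod (x i) - cmod (y i)"]
      by (simp add: power2_diff power2_sum)
    finally show "(cmod (x i + y i))\<^sup>2 \<le> 2 * (cmod (x i))\<^sup>2 + 2 * (cmod (y i))\<^sup>2" .
  qed auto
qed

lemma ell2_scale_summable:
  fixes x :: "'i \<Rightarrow> complex"
  assumes "(\<lambda>i. (cmod (x i))\<^sup>2) summable_on UNIV"
  shows "(\<lambda>i. (cmod (c * x i))\<^sup>2) summable_on UNIV"
  using summable_on_cmult_right[OF assms, of "(cmod c)\<^sup>2"]
  by (simp add: norm_mult power_mult_distrib)

lift_definition scaleC :: "complex \<Rightarrow> 'i ell2 \<Rightarrow> 'i ell2"  (infixr "*\<^sub>C" 75)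
  is "\<lambda>c x i. c * x i"
  by (rule ell2_scale_summable)

text \<open>The inner product is linear in its first argument.\<close>

lift_definition cinner :: "'i ell2 \<Rightarrow> 'i ell2 \<Rightarrow> complex"
  is "\<lambda>x y. \<Sum>\<^sub>\<infinity>i. x i * cnj (y i)" .

instantiation ell2 :: (type) real_inner
begin

lift_definition zero_ell2 :: "'a ell2" is "\<lambda>_. 0"
  by simp

lift_definition plus_ell2 :: "'a ell2 \<Rightarrow> 'a ell2 \<Rightarrow> 'a ell2" is "\<lambda>x y i. x i + y i"
  by (rule ell2_add_summable)

lift_definition uminus_ell2 :: "'a ell2 \<Rightarrow> 'a ell2" is "\<lambda>x i. - x i"
  by simp

lift_definition minus_ell2 :: "'a ell2 \<Rightarrow> 'a ell2 \<Rightarrow> 'a ell2" is "\<lambda>x y i. x i - y i"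
  subgoal for x y using ell2_add_summable[of x "\<lambda>i. - y i"] by simp
  done

definition scaleR_ell2 :: "real \<Rightarrow> 'a ell2 \<Rightarrow> 'a ell2"
  where "scaleR_ell2 r x = complex_of_real r *\<^sub>C x"

lift_definition norm_ell2 :: "'a ell2 \<Rightarrow> real" is "\<lambda>x. sqrt (\<Sum>\<^sub>\<infinity>i. (cmod (x i))\<^sup>2)" .

definition inner_ell2 :: "'a ell2 \<Rightarrow> 'a ell2 \<Rightarrow> real"
  where "inner_ell2 x y = Re (cinner x y)"

definition dist_ell2 :: "'a ell2 \<Rightarrow> 'a ell2 \<Rightarrow> real"
  where "dist_ell2 x y = norm (x - y)"

definition sgn_ell2 :: "'a ell2 \<Rightarrow> 'a ell2"
  where "sgn_ell2 x = inverse (norm x) *\<^sub>R x"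

definition uniformity_ell2 :: "('a ell2 \<times> 'a ell2) filter"
  where "uniformity_ell2 = (INF e\<in>{0<..}. principal {(x, y). dist x y < e})"

definition open_ell2 :: "'a ell2 set \<Rightarrow> bool"
  where "open_ell2 U = (\<forall>x\<in>U. \<forall>\<^sub>F (x', y) in uniformity. x' = x \<longrightarrow> y \<in> U)"

instance
proof
  fix x y z :: "'a ell2" and a b r :: real
  show "x + y + z = x + (y + z)" by transfer (simp add: add.assoc)
  show "x + y = y + x" by transfer (simp add: add.commute)
  show "0 + x = x" by transfer simp
  show "- x + x = 0" by transfer simp
  show "x - y = x + - y" by transfer simp
  show "a *\<^sub>R (x + y) = a *\<^sub>R x + a *\<^sub>R y"
    unfolding scaleR_ell2_def by transfer (simp add: distrib_left)
  show "(a + b) *\<^sub>R x = a *\<^sub>R x + b *\<^sub>R x"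
    unfolding scaleR_ell2_def by transfer (simp add: distrib_right)
  show "a *\<^sub>R b *\<^sub>R x = (a * b) *\<^sub>R x"
    unfolding scaleR_ell2_def by transfer (simp add: mult.assoc)
  show "1 *\<^sub>R x = x"
    unfolding scaleR_ell2_def by transfer simp
  show "dist x y = norm (x - y)" by (rule dist_ell2_def)
  show "sgn x = inverse (norm x) *\<^sub>R x" by (rule sgn_ell2_def)
  show "uniformity = (INF e\<in>{0<..}. principal {(x, y). dist x (y :: 'a ell2) < e})"
    by (rule uniformity_ell2_def)
  show "open U = (\<forall>x\<in>U. \<forall>\<^sub>F (x', y) in uniformity. x' = x \<longrightarrow> y \<in> U)" for U :: "'a ell2 set"
    by (rule open_ell2_def)
  have re: "inner u v = (\<Sum>\<^sub>\<infinity>i. Re (coord u i * cnj (coord v i)))" for u v :: "'a ell2"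
    unfolding inner_ell2_def cinner.rep_eq
    by (intro infsum_Re[symmetric] ell2_mult_summable) (use coord in auto)
  have sq: "inner u u = (\<Sum>\<^sub>\<infinity>i. (cmod (coord u i))\<^sup>2)" for u :: "'a ell2"
    unfolding re by (intro infsum_cong) (simp add: cmod_power2 flip: power2_eq_square)
  show "inner x y = inner y x"
    unfolding re by (intro infsum_cong) (simp add: mult.commute)
  show "inner (x + y) z = inner x z + inner y z"
  proof -
    have "cinner (x + y) z = cinner x z + cinner y z"
      by transfer (simp add: distrib_right infsum_add ell2_mult_summable)
    then show ?thesis by (simp add: inner_ell2_def)
  qed
  show "inner (r *\<^sub>R x) y = r * inner x y"
  proof -
    have "cinner (complex_of_real r *\<^sub>C x) y = complex_of_real r * cinner x y"
      by transfer (simp add: mult.assoc infsum_cmult_right')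
    then show ?thesis by (simp add: inner_ell2_def scaleR_ell2_def)
  qed
  show "0 \<le> inner x x"
    unfolding sq by (intro infsum_nonneg) simp
  show "norm x = sqrt (inner x x)"
    unfolding sq norm_ell2.rep_eq ..
  show "inner x x = 0 \<longleftrightarrow> x = 0"
  proof
    assume "inner x x = 0"
    then have "(\<Sum>\<^sub>\<infinity>i. (cmod (coord x i))\<^sup>2) \<le> 0" by (simp add: sq)
    moreover have "(\<lambda>i. (cmod (coord x i))\<^sup>2) summable_on UNIV" using coord[of x] by simp
    ultimately have "(cmod (coord x i))\<^sup>2 = 0" for i
      by (rule nonneg_infsum_le_0D) auto
    then have "coord x = (\<lambda>_. 0)" by auto
    then show "x = 0" by (simp add: coord_inject[symmetric] zero_ell2.rep_eq)
  next
    assume "x = 0"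
    then show "inner x x = 0" by (simp add: sq zero_ell2.rep_eq)
  qed
qed

end

global_interpretation ell2: vector_space "scaleC :: complex \<Rightarrow> 'i ell2 \<Rightarrow> 'i ell2"
  by standard (transfer; simp add: algebra_simps)+

lemma norm_scaleC: "norm (c *\<^sub>C x) = cmod c * norm x"
  by transfer (simp add: norm_mult power_mult_distrib infsum_cmult_right' real_sqrt_mult)

lift_definition basis_vec :: "'i \<Rightarrow> 'i ell2"  ("\<xi>")
  is "\<lambda>i j. if j = i then 1 else 0"
proof -
  fix i :: 'i
  have "(\<lambda>j. (cmod (if j = i then 1 else 0))\<^sup>2) summable_on UNIV
      \<longleftrightarrow> (\<lambda>j. (cmod (if j = i then 1 else 0))\<^sup>2) summable_on {i}"
    by (intro summable_on_cong_neutral) auto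
  then show "(\<lambda>j. (cmod (if j = i then 1 else 0))\<^sup>2) summable_on UNIV"
    by simp
qed

section \<open>Bounded operators and the weak operator topology\<close>

text \<open>
  The type \<open>'i ell2 \<Rightarrow>\<^sub>L 'i ell2\<close> consists of the bounded \<^emph>\<open>real\<close>-linear operators;
  \<open>\<B>(\<H>)\<close> is the subset of the complex-linear ones.
\<close>

definition bounded_ops :: "('i ell2 \<Rightarrow>\<^sub>L 'i ell2) set"
  where "bounded_ops = {T. \<forall>c x. blinfun_apply T (c *\<^sub>C x) = c *\<^sub>C blinfun_apply T x}"

text \<open>The coarsest topology on \<open>\<B>(\<H>)\<close> making every \<open>T \<mapsto> \<langle>T x, y\<rangle>\<close> continuous.\<close>

definition weak_operator_topology :: "('i ell2 \<Rightarrow>\<^sub>L 'i ell2) topology"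
  where "weak_operator_topology =
    pullback_topology bounded_ops (\<lambda>T (x, y). cinner (blinfun_apply T x) y) euclidean"

lemma bounded_linear_scaleC: "bounded_linear (\<lambda>x :: 'i ell2. c *\<^sub>C x)"
proof (rule bounded_linear_intro[where K = "cmod c"])
  show "c *\<^sub>C (r *\<^sub>R x) = r *\<^sub>R (c *\<^sub>C x)" for r and x :: "'i ell2"
    unfolding scaleR_ell2_def by (rule ell2.scale_left_commute)
qed (simp_all add: ell2.scale_right_distrib norm_scaleC mult.commute)

lift_definition scalar_op :: "complex \<Rightarrow> 'i ell2 \<Rightarrow>\<^sub>L 'i ell2"
  is "\<lambda>c x. c *\<^sub>C x"
  by (rule bounded_linear_scaleC)

definition unital_subalgebra :: "('i ell2 \<Rightarrow>\<^sub>L 'i ell2) set \<Rightarrow> bool"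
  where "unital_subalgebra A \<longleftrightarrow>
    A \<subseteq> bounded_ops \<and> id_blinfun \<in> A \<and>
    (\<forall>S\<in>A. \<forall>T\<in>A. S + T \<in> A \<and> S o\<^sub>L T \<in> A) \<and>
    (\<forall>c. \<forall>T\<in>A. scalar_op c o\<^sub>L T \<in> A)"

section \<open>The non-commutative analytic Toeplitz algebra\<close>

text \<open>
  The generators are the elements of a finite type \<open>'n\<close>, so \<open>n = CARD('n)\<close>. The free unital
  semigroup is \<open>'n list\<close> with concatenation and unit \<open>[]\<close>, and the Fock space is \<open>'n list ell2\<close>.
\<close>

definition shift_coord :: "'n \<Rightarrow> ('n list \<Rightarrow> complex) \<Rightarrow> 'n list \<Rightarrow> complex"
  where "shift_coord i x w = (case w of [] \<Rightarrow> 0 | j # v \<Rightarrow> if j = i then x v else 0)"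

lemma shift_coord_has_sum:
  assumes "((\<lambda>w. (cmod (x w))\<^sup>2) has_sum s) UNIV"
  shows "((\<lambda>w. (cmod (shift_coord i x w))\<^sup>2) has_sum s) UNIV"
proof -
  have "((\<lambda>w. (cmod (shift_coord i x w))\<^sup>2) has_sum s) (range ((#) i))"
    by (subst has_sum_reindex) (use assms in \<open>auto simp: shift_coord_def o_def\<close>)
  moreover have "shift_coord i x w = 0" if "w \<notin> range ((#) i)" for w
    using that by (auto simp: shift_coord_def split: list.splits)
  ultimately show ?thesis
    by (subst has_sum_cong_neutral[where T = "range ((#) i)"]) auto
qed

lift_definition shift_vec :: "'n \<Rightarrow> 'n list ell2 \<Rightarrow> 'n list ell2" is shift_coord
  using shift_coord_has_sum by (fastforce simp: summable_on_def)

lemma norm_shift_vec: "norm (shift_vec i x) = norm x"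
proof transfer
  fix i :: 'n and x :: "'n list \<Rightarrow> complex"
  assume "(\<lambda>w. (cmod (x w))\<^sup>2) summable_on UNIV"
  then show "sqrt (\<Sum>\<^sub>\<infinity>w. (cmod (shift_coord i x w))\<^sup>2) = sqrt (\<Sum>\<^sub>\<infinity>w. (cmod (x w))\<^sup>2)"
    using infsumI[OF shift_coord_has_sum] has_sum_infsum by metis
qed

lemma shift_vec_scaleC: "shift_vec i (c *\<^sub>C x) = c *\<^sub>C shift_vec i x"
  by transfer (auto simp: shift_coord_def fun_eq_iff split: list.splits)

lift_definition L :: "'n \<Rightarrow> 'n list ell2 \<Rightarrow>\<^sub>L 'n list ell2" is shift_vec
proof (rule bounded_linear_intro[where K = 1])
  fix i :: 'n and x y :: "'n list ell2" and r :: real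
  show "shift_vec i (x + y) = shift_vec i x + shift_vec i y"
    by transfer (auto simp: shift_coord_def fun_eq_iff split: list.splits)
qed (simp_all add: norm_shift_vec shift_vec_scaleC scaleR_ell2_def)

lemma L_basis_vec: "blinfun_apply (L i) (\<xi> v) = \<xi> (i # v)"
  unfolding L.rep_eq coord_inject[symmetric] shift_vec.rep_eq basis_vec.rep_eq
  by (auto simp: shift_coord_def fun_eq_iff split: list.splits)

lemma L_isometry: "norm (blinfun_apply (L i) x) = norm x"
  by (simp add: L.rep_eq norm_shift_vec)

lemma L_in_bounded_ops: "L i \<in> bounded_ops"
  by (simp add: bounded_ops_def L.rep_eq shift_vec_scaleC)

text \<open>The smallest unital WOT-closed algebra of bounded operators containing all \<open>L i\<close>.\<close>

definition nc_toeplitz :: "('n::finite list ell2 \<Rightarrow>\<^sub>L 'n list ell2) set"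
  where "nc_toeplitz =
    (\<lambda>A. unital_subalgebra A \<and> closedin weak_operator_topology A) hull range L"

definition Lat :: "('i ell2 \<Rightarrow>\<^sub>L 'i ell2) set \<Rightarrow> 'i ell2 set set"
  where "Lat A =
    {M. ell2.subspace M \<and> closed M \<and> (\<forall>T\<in>A. \<forall>x\<in>M. blinfun_apply T x \<in> M)}"

definition left_ideal :: "'n::finite list ell2 set \<Rightarrow> ('n list ell2 \<Rightarrow>\<^sub>L 'n list ell2) set"
  where "left_ideal M = {J \<in> nc_toeplitz. blinfun_apply J (\<xi> []) \<in> M}"

lemma unital_subalgebra_bounded_ops: "unital_subalgebra bounded_ops"
proof -
  have "c *\<^sub>C (d *\<^sub>C x) = d *\<^sub>C (c *\<^sub>C x)" for c d and x :: "'i ell2"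
    by (rule ell2.scale_left_commute)
  then show ?thesis
    by (auto simp: unital_subalgebra_def bounded_ops_def blinfun.add_left
        ell2.scale_right_distrib scalar_op.rep_eq)
qed

lemma topspace_weak_operator_topology: "topspace weak_operator_topology = bounded_ops"
  by (simp add: weak_operator_topology_def topspace_pullback_topology)

text \<open>
  The hull is an intersection over a nonempty family, because \<open>\<B>(\<H>)\<close> belongs to it, and is
  itself a member of that family.
\<close>

lemma nc_toeplitz_properties:
  "unital_subalgebra nc_toeplitz" "closedin weak_operator_topology nc_toeplitz" "L i \<in> nc_toeplitz"
proof -
  let ?P = "\<lambda>A. unital_subalgebra A \<and> closedin weak_operator_topology A"
  let ?F = "{A. ?P A \<and> range L \<subseteq> A}"
  have B: "bounded_ops \<in> ?F"
    using unital_subalgebra_bounded_ops L_in_bounded_ops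
      closedin_topspace[of weak_operator_topology]
    by (auto simp: topspace_weak_operator_topology)
  have eq: "nc_toeplitz = \<Inter>?F"
    by (simp add: nc_toeplitz_def hull_def)
  show "closedin weak_operator_topology nc_toeplitz"
    unfolding eq using B by (intro closedin_Inter) auto
  have "nc_toeplitz \<subseteq> bounded_ops"
    unfolding eq using B by (rule Inter_lower)
  then show "unital_subalgebra nc_toeplitz"
    unfolding unital_subalgebra_def by (auto simp: eq unital_subalgebra_def)
  show "L i \<in> nc_toeplitz"
    unfolding eq by auto
qed

end

theory Submission
  imports Defs
begin

text \<open>
  An element \<open>T\<close> of the non-commutative analytic Toeplitz algebra commutes with all right
  translations, so it is left convolution by \<open>h = T \<xi>\<^sub>1\<close>, and \<open>T = 0\<close> if \<open>h = 0\<close>. The vectors \<open>h\<close>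
  that arise in this way are far from all of \<open>\<H>\<close>, since the convolution must be bounded. The
  idea is to find an invariant subspace that contains no nonzero vector with this property.

  Fix a letter \<open>a\<close>. A word is either a power of \<open>a\<close> or can be written uniquely as \<open>w j a\<^sup>k\<close> with a
  letter \<open>j \<noteq> a\<close>. The subspace \<open>M\<close> (\<open>harmonic_subspace a\<close>) consists of the vectors
  whose coordinate at \<open>w j a\<^sup>k\<close> is \<open>1/(k+1)\<close> times the one at \<open>w j\<close>, and which vanish on the powers
  of \<open>a\<close>.
  It is nonzero as soon as there is a letter other than \<open>a\<close>, because the numbers \<open>1/(k+1)\<close> are
  square-summable. It is invariant because left multiplication acts on \<open>w\<close> only and leaves the
  tail \<open>a\<^sup>k\<close> alone.

  In the variable \<open>a\<close>, every vector of \<open>M\<close> ends in the power series \<open>f(z) = \<Sum> z\<^sup>k/(k+1)\<close>. This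
  \<open>f\<close> is in the Hardy space \<open>H\<^sup>2\<close> but is an unbounded function, so multiplication by \<open>f\<close> is
  unbounded. Correspondingly, left convolution by a nonzero \<open>h \<in> M\<close> is unbounded on the span of
  the \<open>\<xi>\<close> of powers of \<open>a\<close>. Concretely, let \<open>g\<close> be the sum of \<open>\<xi>\<close> over the first \<open>N\<close> powers of
  \<open>a\<close>. For \<open>m < N\<close>, the coordinate of \<open>T g\<close> at \<open>w j a\<^sup>m\<close> is \<open>h\<^bsub>wj\<^esub>\<close> times the harmonic number
  \<open>H\<^bsub>m+1\<^esub>\<close> (\<open>nc_toeplitz_coord_sum_powers\<close>), whereas the norm of \<open>g\<close> is the square root of \<open>N\<close>.
  Comparing norms bounds \<open>H\<^bsub>N/2\<^esub> |h\<^bsub>wj\<^esub>|\<close> by a multiple of the norm of \<open>T\<close>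
  (\<open>nc_toeplitz_harmonic_bound\<close>). The harmonic numbers are unbounded, so all \<open>h\<^bsub>wj\<^esub>\<close> vanish and
  \<open>T = 0\<close>.
\<close>

section \<open>Coordinates of square-summable families\<close>

lemma cinner_basis_vec: "cinner x (\<xi> w) = coord x w"
proof -
  have "cinner x (\<xi> w) = (\<Sum>\<^sub>\<infinity>i\<in>{w}. coord x i * cnj (if i = w then 1 else 0))"
    unfolding cinner.rep_eq basis_vec.rep_eq by (rule infsum_cong_neutral) auto
  then show ?thesis by simp
qed

lemma ell2_eqI: "(\<And>w. coord x w = coord y w) \<Longrightarrow> x = y"
  by (simp add: coord_inject[symmetric] fun_eq_iff)

lemma norm_square: "(norm x)\<^sup>2 = (\<Sum>\<^sub>\<infinity>w. (cmod (coord x w))\<^sup>2)"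
  unfolding norm_ell2.rep_eq by (simp add: infsum_nonneg)

lemma coord_square_summable: "(\<lambda>w. (cmod (coord x w))\<^sup>2) summable_on UNIV"
  using coord[of x] by simp

lemma sum_coord_square_le_norm_square:
  assumes "finite F"
  shows "(\<Sum>w\<in>F. (cmod (coord x w))\<^sup>2) \<le> (norm x)\<^sup>2"
  unfolding norm_square
  by (rule finite_sum_le_infsum[OF coord_square_summable assms]) auto

lemma bounded_linear_coord: "bounded_linear (\<lambda>x. coord x w)"
proof (rule bounded_linear_intro[where K = 1])
  show "cmod (coord x w) \<le> norm x * 1" for x :: "'a ell2"
    using sum_coord_square_le_norm_square[of "{w}" x] by (simp add: power2_le_iff_abs_le)
qed (simp_all add: plus_ell2.rep_eq scaleR_ell2_def scaleC.rep_eq scaleR_conv_of_real)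

lemma coord_sum: "coord (\<Sum>k\<in>A. f k) w = (\<Sum>k\<in>A. coord (f k) w)"
  using bounded_linear_coord[of w] linear_sum[OF bounded_linear.linear] by blast

lemma continuous_on_coord [continuous_intros]:
  "continuous_on S f \<Longrightarrow> continuous_on S (\<lambda>x. coord (f x) w)"
  by (rule bounded_linear.continuous_on[OF bounded_linear_coord])

lemma inner_basis_vec: "inner (\<xi> v) (\<xi> w) = (if v = w then 1 else 0)"
  by (simp add: inner_ell2_def cinner_basis_vec basis_vec.rep_eq)

lemma norm_sum_basis_vec_square:
  assumes "inj_on f A" "finite A"
  shows "(norm (\<Sum>k\<in>A. \<xi> (f k)))\<^sup>2 = card A"
proof -
  have "(norm (\<Sum>k\<in>A. \<xi> (f k)))\<^sup>2 = (\<Sum>k\<in>A. (norm (\<xi> (f k)))\<^sup>2)"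
    using assms
    by (intro norm_sum_Pythagorean)
      (auto simp: pairwise_def orthogonal_def inner_basis_vec dest: inj_onD)
  then show ?thesis
    by (simp add: power2_norm_eq_inner inner_basis_vec)
qed

text \<open>
  The truncations of \<open>x\<close> to finite sets of words are in \<open>V\<close>, and the square of their distance
  from \<open>x\<close> is the tail of a convergent sum.
\<close>

lemma closed_subspace_containing_basis:
  assumes "closed V" "ell2.subspace V" "\<And>w. \<xi> w \<in> V"
  shows "x \<in> V"
proof -
  have "x \<in> closure V"
  proof (unfold closure_approachable, intro allI impI)
    fix e :: real assume "e > 0"
    let ?f = "\<lambda>w. (cmod (coord x w))\<^sup>2"
    obtain F where F: "finite F" "dist (sum ?f F) (infsum ?f UNIV) \<le> e\<^sup>2 / 2"
      using infsum_finite_approximation[OF coord_square_summable, of "e\<^sup>2/2" x] \<open>e > 0\<close> by auto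
    define y where "y = (\<Sum>w\<in>F. coord x w *\<^sub>C \<xi> w)"
    have cy: "coord y w = (if w \<in> F then coord x w else 0)" for w
    proof -
      have "coord y w = (\<Sum>v\<in>F. if w = v then coord x v else 0)"
        unfolding y_def coord_sum
        by (intro sum.cong) (auto simp: scaleC.rep_eq basis_vec.rep_eq)
      then show ?thesis using \<open>finite F\<close> by simp
    qed
    have "(norm (y - x))\<^sup>2 = infsum ?f (UNIV - F)"
      unfolding norm_square
      by (rule infsum_cong_neutral) (auto simp: minus_ell2.rep_eq cy)
    also have "\<dots> = infsum ?f UNIV - sum ?f F"
      using F(1) coord_square_summable[of x] by (subst infsum_Diff) auto
    also have "\<dots> \<le> e\<^sup>2 / 2" using F(2) unfolding dist_real_def by arith
    also have "\<dots> < e\<^sup>2" using \<open>e > 0\<close> by simp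
    finally have "dist y x < e"
      using \<open>e > 0\<close> by (simp add: dist_norm power_less_imp_less_base)
    moreover have "y \<in> V"
      unfolding y_def by (intro ell2.subspace_sum ell2.subspace_scale assms)
    ultimately show "\<exists>y\<in>V. dist y x < e" by blast
  qed
  with \<open>closed V\<close> show ?thesis by simp
qed

section \<open>Weakly closed algebras\<close>

text \<open>
  An equation that depends continuously on the matrix coefficients of \<open>T\<close> defines a closed set, and so does any family of such equations. The topology on functions is the product
  topology, so the continuous \<open>g p\<close> include all polynomials in finitely many coefficients.
\<close>

lemma closedin_weak_operator_topology:
  fixes g :: "'p \<Rightarrow> ('i ell2 \<times> 'i ell2 \<Rightarrow> complex) \<Rightarrow> complex"
  assumes "\<And>p. p \<in> P \<Longrightarrow> continuous_on UNIV (g p)"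
  shows "closedin weak_operator_topology
    {T \<in> bounded_ops. \<forall>p\<in>P. g p (\<lambda>(x, y). cinner (blinfun_apply T x) y) = 0}"
proof -
  let ?ev = "\<lambda>T (x, y). cinner (blinfun_apply T x) y"
  let ?A = "\<lambda>p. {T \<in> bounded_ops. g p (?ev T) = 0}"
  have closed: "closedin weak_operator_topology (?A p)" if "p \<in> P" for p
  proof -
    have "continuous_map weak_operator_topology euclidean (g p \<circ> ?ev)"
      unfolding weak_operator_topology_def
      by (rule continuous_map_pullback) (use assms[OF that] in simp)
    from closedin_continuous_map_preimage[OF this, of "{0}"] show ?thesis
      by (simp add: topspace_weak_operator_topology)
  qed
  have "{T \<in> bounded_ops. \<forall>p\<in>P. g p (?ev T) = 0}
      = \<Inter>(insert (topspace weak_operator_topology) (?A ` P))"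
    by (auto simp: topspace_weak_operator_topology)
  then show ?thesis
    using closed by (simp only:) (intro closedin_Inter; auto)
qed

lemma nc_toeplitz_least:
  assumes "closedin weak_operator_topology A" "unital_subalgebra A" "\<And>i. L i \<in> A"
  shows "nc_toeplitz \<subseteq> A"
  unfolding nc_toeplitz_def using assms by (intro hull_minimal) auto

lemma scaleC_nc_toeplitz: "T \<in> nc_toeplitz \<Longrightarrow> scalar_op c o\<^sub>L T \<in> nc_toeplitz"
  using nc_toeplitz_properties(1)[unfolded unital_subalgebra_def] by blast

lemma zero_in_nc_toeplitz: "0 \<in> nc_toeplitz"
proof -
  have "0 = scalar_op 0 o\<^sub>L L i" for i :: 'a
    by (rule blinfun_eqI) (simp add: scalar_op.rep_eq)
  then show ?thesis
    using scaleC_nc_toeplitz[OF nc_toeplitz_properties(3)] by metis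
qed

lemma nc_toeplitz_scaleC:
  "T \<in> nc_toeplitz \<Longrightarrow> blinfun_apply T (c *\<^sub>C x) = c *\<^sub>C blinfun_apply T x"
  using nc_toeplitz_properties(1) by (auto simp: unital_subalgebra_def bounded_ops_def)

section \<open>Right translations\<close>

definition right_shift_coord :: "'n \<Rightarrow> ('n list \<Rightarrow> complex) \<Rightarrow> 'n list \<Rightarrow> complex"
  where "right_shift_coord j x w = (if w \<noteq> [] \<and> last w = j then x (butlast w) else 0)"

lift_definition right_shift :: "'n \<Rightarrow> 'n list ell2 \<Rightarrow> 'n list ell2" is right_shift_coord
proof -
  fix j :: 'n and x :: "'n list \<Rightarrow> complex"
  let ?f = "\<lambda>w. (cmod (right_shift_coord j x w))\<^sup>2"
  assume "(\<lambda>w. (cmod (x w))\<^sup>2) summable_on UNIV"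
  then have "?f summable_on range (\<lambda>w. w @ [j])"
    by (subst summable_on_reindex) (auto simp: inj_on_def o_def right_shift_coord_def)
  moreover have "?f w = 0" if "w \<notin> range (\<lambda>w. w @ [j])" for w
    using that by (cases w rule: rev_cases) (auto simp: right_shift_coord_def)
  ultimately show "?f summable_on UNIV"
    by (subst summable_on_cong_neutral[where T = "range (\<lambda>w. w @ [j])"]) auto
qed

lemma coord_right_shift:
  "coord (right_shift j x) [] = 0"
  "coord (right_shift j x) (w @ [i]) = (if i = j then coord x w else 0)"
  by (simp_all add: right_shift.rep_eq right_shift_coord_def)

lemma right_shift_basis_vec: "right_shift j (\<xi> w) = \<xi> (w @ [j])"
proof (rule ell2_eqI)
  show "coord (right_shift j (\<xi> w)) v = coord (\<xi> (w @ [j])) v" for v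
    by (cases v rule: rev_cases) (auto simp: coord_right_shift basis_vec.rep_eq)
qed

lemma right_shift_0: "right_shift j 0 = 0"
  by (rule ell2_eqI) (simp add: right_shift.rep_eq right_shift_coord_def zero_ell2.rep_eq)

lemma right_shift_add: "right_shift j (x + y) = right_shift j x + right_shift j y"
  by (rule ell2_eqI) (simp add: right_shift.rep_eq right_shift_coord_def plus_ell2.rep_eq)

lemma right_shift_scaleC: "right_shift j (c *\<^sub>C x) = c *\<^sub>C right_shift j x"
  by (rule ell2_eqI) (simp add: right_shift.rep_eq right_shift_coord_def scaleC.rep_eq)

lemma L_right_shift:
  "blinfun_apply (L i) (right_shift j x) = right_shift j (blinfun_apply (L i) x)"
proof (rule ell2_eqI)
  show "coord (blinfun_apply (L i) (right_shift j x)) w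
      = coord (right_shift j (blinfun_apply (L i) x)) w" for w
    by (auto simp: L.rep_eq shift_vec.rep_eq right_shift.rep_eq shift_coord_def
        right_shift_coord_def split: list.splits)
qed

text \<open>
  Left and right translations commute, and commuting with a fixed right translation is an
  algebraic condition that survives weak limits, as it can be tested coordinate by coordinate.
\<close>

lemma nc_toeplitz_right_shift:
  fixes T :: "'n::finite list ell2 \<Rightarrow>\<^sub>L 'n list ell2"
  assumes "T \<in> nc_toeplitz"
  shows "blinfun_apply T (right_shift j x) = right_shift j (blinfun_apply T x)"
proof -
  let ?A = "{T \<in> bounded_ops. \<forall>j x. blinfun_apply T (right_shift j x)
      = right_shift j (blinfun_apply T (x :: 'n list ell2))}"
  let ?g = "\<lambda>(j, x :: 'n list ell2, w) F. F (right_shift j x, \<xi> w)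
      - (if w \<noteq> [] \<and> last w = j then F (x, \<xi> (butlast w)) else 0) :: complex"
  let ?ev = "\<lambda>T (x, y). cinner (blinfun_apply T x) y"
  have "blinfun_apply T (right_shift j x) = right_shift j (blinfun_apply T x)
      \<longleftrightarrow> (\<forall>w. ?g (j, x, w) (?ev T) = 0)"
    for T :: "'n list ell2 \<Rightarrow>\<^sub>L 'n list ell2" and j x
    unfolding coord_inject[symmetric] fun_eq_iff
    by (simp add: cinner_basis_vec right_shift.rep_eq right_shift_coord_def)
  then have A_eq: "?A = {T \<in> bounded_ops. \<forall>p\<in>UNIV. ?g p (?ev T) = 0}"
    by (simp only: split_paired_All ball_UNIV)
  have "continuous_on UNIV (?g (j, x, w))" for j x w
    by (cases "w \<noteq> [] \<and> last w = j")
      (auto intro!: continuous_on_diff continuous_on_product_coordinates)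
  then have "continuous_on UNIV (?g p)" for p
    by (cases p) (simp only:)
  then have "closedin weak_operator_topology ?A"
    unfolding A_eq by (rule closedin_weak_operator_topology)
  moreover have "unital_subalgebra ?A"
    using unital_subalgebra_bounded_ops
    by (auto simp: unital_subalgebra_def blinfun.add_left right_shift_add
        scalar_op.rep_eq right_shift_scaleC)
  ultimately have "nc_toeplitz \<subseteq> ?A"
    by (rule nc_toeplitz_least) (simp add: L_in_bounded_ops L_right_shift)
  with assms show ?thesis by auto
qed

text \<open>
  The vector \<open>T \<xi>\<^sub>1\<close> determines \<open>T \<xi>\<^sub>w\<close> for every \<open>w\<close>, because \<open>\<xi>\<^sub>w\<close> is a right translate of
  \<open>\<xi>\<^sub>1\<close>.
\<close>

lemma nc_toeplitz_eq_0:
  assumes T: "T \<in> nc_toeplitz" and "blinfun_apply T (\<xi> []) = 0"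
  shows "T = 0"
proof -
  have basis: "blinfun_apply T (\<xi> w) = 0" for w
    by (induction w rule: rev_induct)
      (simp_all add: assms nc_toeplitz_right_shift right_shift_0 flip: right_shift_basis_vec)
  have "closed {x. blinfun_apply T x = 0}"
    by (intro closed_Collect_eq continuous_intros)
  moreover have "ell2.subspace {x. blinfun_apply T x = 0}"
    by (auto simp: ell2.subspace_def blinfun.add_right nc_toeplitz_scaleC[OF T])
  ultimately have "x \<in> {x. blinfun_apply T x = 0}" for x
    by (rule closed_subspace_containing_basis) (simp add: basis)
  then show ?thesis by (intro blinfun_eqI) simp
qed

text \<open>
  Here \<open>T \<xi>\<^bsub>a^k\<^esub>\<close> is \<open>T \<xi>\<^sub>1\<close> with \<open>a\<^sup>k\<close> appended to all words. Stripping \<open>k\<close> letters \<open>a\<close> from the end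
  of \<open>w j a\<^sup>m\<close> is possible only if \<open>k \<le> m\<close>, as \<open>j\<close> differs from \<open>a\<close>.
\<close>

lemma nc_toeplitz_basis_vec_coord:
  assumes T: "T \<in> nc_toeplitz" and "j \<noteq> a"
  shows "coord (blinfun_apply T (\<xi> (replicate k a))) (w @ j # replicate m a)
    = (if k \<le> m then coord (blinfun_apply T (\<xi> [])) (w @ j # replicate (m - k) a) else 0)"
proof (induction k arbitrary: m)
  case (Suc k)
  have shift: "\<xi> (replicate (Suc k) a) = right_shift a (\<xi> (replicate k a))"
    by (simp add: right_shift_basis_vec replicate_append_same)
  show ?case
  proof (cases m)
    case 0
    then show ?thesis
      using coord_right_shift(2)[of a _ w j] \<open>j \<noteq> a\<close>
      by (simp only: shift nc_toeplitz_right_shift[OF T]) simp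
  next
    case (Suc l)
    have "w @ j # replicate m a = (w @ j # replicate l a) @ [a]"
      by (simp add: Suc replicate_append_same)
    then show ?thesis
      using Suc.IH[of l]
      by (simp only: shift nc_toeplitz_right_shift[OF T] coord_right_shift) (simp add: Suc)
  qed
qed simp

section \<open>The invariant subspace\<close>

text \<open>
  The coordinates along \<open>w j a\<^sup>k\<close> are \<open>1, 1/2, 1/3, \<dots>\<close> times a number that depends on \<open>w j\<close> only.
  As a set of solutions of linear equations between coordinates, the subspace is closed, and the
  stabiliser of the subspace is weakly closed.
\<close>

definition harmonic_subspace :: "'n \<Rightarrow> 'n list ell2 set"
  where "harmonic_subspace a = {x. (\<forall>k. coord x (replicate k a) = 0) \<and>
    (\<forall>w j k. j \<noteq> a \<longrightarrow>
      of_nat (Suc k) * coord x (w @ j # replicate k a) = coord x (w @ [j]))}"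

lemma harmonic_subspace_subspace: "ell2.subspace (harmonic_subspace a)"
  by (auto simp: ell2.subspace_def harmonic_subspace_def zero_ell2.rep_eq plus_ell2.rep_eq
      scaleC.rep_eq distrib_left mult.left_commute[of _ c for c])

lemma closed_harmonic_subspace: "closed (harmonic_subspace a)"
  unfolding harmonic_subspace_def
  by (intro closed_Collect_conj closed_Collect_all closed_Collect_imp closed_Collect_eq
      continuous_intros) auto

text \<open>
  \<open>L i\<close> prepends a letter and does not touch the tail of a word. The one delicate point is the
  empty word \<open>w\<close>: the coordinate of \<open>L i x\<close> at \<open>j a\<^sup>k\<close> with \<open>j = i\<close> comes from \<open>a\<^sup>k\<close>, and this is
  why the vectors of the subspace are required to vanish on the powers of \<open>a\<close>.
\<close>

lemma L_harmonic_subspace: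
  assumes x: "x \<in> harmonic_subspace a"
  shows "blinfun_apply (L i) x \<in> harmonic_subspace a"
proof -
  have "coord (blinfun_apply (L i) x) (replicate k a) = 0" for k
    using x by (cases k) (auto simp: L.rep_eq shift_vec.rep_eq shift_coord_def
        harmonic_subspace_def)
  moreover have "of_nat (Suc k) * coord (blinfun_apply (L i) x) (w @ j # replicate k a)
      = coord (blinfun_apply (L i) x) (w @ [j])" if "j \<noteq> a" for w j k
  proof (cases w)
    case Nil
    have "coord x (replicate l a) = 0" for l
      using x by (simp add: harmonic_subspace_def)
    from this[of k] this[of 0] show ?thesis
      by (simp add: Nil L.rep_eq shift_vec.rep_eq shift_coord_def)
  next
    case (Cons i' v)
    have "of_nat (Suc k) * coord x (v @ j # replicate k a) = coord x (v @ [j])"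
      using x that unfolding harmonic_subspace_def by blast
    then show ?thesis
      by (simp add: Cons L.rep_eq shift_vec.rep_eq shift_coord_def)
  qed
  ultimately show ?thesis
    unfolding harmonic_subspace_def by blast
qed

lemma harmonic_subspace_in_Lat:
  fixes a :: "'n::finite"
  shows "harmonic_subspace a \<in> Lat nc_toeplitz"
proof -
  let ?M = "harmonic_subspace a"
  let ?A = "{T \<in> bounded_ops. \<forall>x\<in>?M. blinfun_apply T x \<in> ?M}"
  let ?ev = "\<lambda>T (x, y). cinner (blinfun_apply T x) y"
  let ?f = "\<lambda>(x, k) F. F (x, \<xi> (replicate k a)) :: complex"
  let ?g = "\<lambda>(x, w, j, k) F.
      of_nat (Suc k) * F (x, \<xi> (w @ j # replicate k a)) - F (x, \<xi> (w @ [j])) :: complex"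
  have mem: "blinfun_apply T x \<in> ?M \<longleftrightarrow> (\<forall>k. ?f (x, k) (?ev T) = 0) \<and>
      (\<forall>w j k. j \<noteq> a \<longrightarrow> ?g (x, w, j, k) (?ev T) = 0)" for T x
    by (simp add: harmonic_subspace_def cinner_basis_vec del: of_nat_Suc)
  have A_eq: "?A = {T \<in> bounded_ops. \<forall>p\<in>?M \<times> UNIV. ?f p (?ev T) = 0} \<inter>
      {T \<in> bounded_ops. \<forall>p\<in>?M \<times> UNIV \<times> (- {a}) \<times> UNIV. ?g p (?ev T) = 0}"
    unfolding mem by (auto simp del: of_nat_Suc split_paired_All)
  have "continuous_on UNIV (?f p)" for p
    by (cases p) (auto intro!: continuous_on_product_coordinates)
  moreover have "continuous_on UNIV (?g p)" for p
    by (cases p) (auto intro!: continuous_intros continuous_on_product_coordinates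
        simp del: of_nat_Suc)
  ultimately have "closedin weak_operator_topology ?A"
    unfolding A_eq by (intro closedin_Int closedin_weak_operator_topology)
  moreover have "unital_subalgebra ?A"
    using unital_subalgebra_bounded_ops harmonic_subspace_subspace[of a]
    by (auto simp: unital_subalgebra_def blinfun.add_left ell2.subspace_def scalar_op.rep_eq)
  ultimately have "nc_toeplitz \<subseteq> ?A"
    by (rule nc_toeplitz_least) (simp add: L_in_bounded_ops L_harmonic_subspace)
  then show ?thesis
    using harmonic_subspace_subspace closed_harmonic_subspace by (auto simp: Lat_def)
qed

lemma harmonic_subspace_nontrivial:
  assumes "b \<noteq> a"
  shows "harmonic_subspace a \<noteq> {0}"
proof -
  let ?W = "range (\<lambda>k. b # replicate k a)"
  \<comment> \<open>The word \<open>b a\<^sup>k\<close> has length \<open>k + 1\<close>, so its coordinate is \<open>1/(k+1)\<close>.\<close>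
  define r :: "'a list \<Rightarrow> complex"
    where "r w = (if w \<in> ?W then 1 / of_nat (length w) else 0)" for w
  have r_W: "r (b # replicate k a) = 1 / of_nat (Suc k)" for k
    by (auto simp: r_def)
  have inj: "inj (\<lambda>k. b # replicate k a)"
    by (auto simp: inj_def)
  have "summable (\<lambda>k. 1 / (real (Suc k))\<^sup>2)"
    using inverse_power_summable[of 2, where ?'a = real]
    by (subst summable_Suc_iff) (simp add: inverse_eq_divide)
  then have "(\<lambda>k. (cmod (r (b # replicate k a)))\<^sup>2) summable_on UNIV"
    by (subst summable_on_UNIV_nonneg_real_iff)
      (auto simp: r_W norm_divide power_divide simp del: of_nat_Suc)
  then have "(\<lambda>w. (cmod (r w))\<^sup>2) summable_on ?W"
    by (subst summable_on_reindex[OF inj]) (simp add: o_def)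
  then have "(\<lambda>w. (cmod (r w))\<^sup>2) summable_on UNIV"
    by (subst summable_on_cong_neutral[where T = ?W]) (auto simp: r_def)
  then have coord_r: "coord (Abs_ell2 r) = r"
    by (simp add: Abs_ell2_inverse)
  have "r (replicate k a) = 0" for k
    using assms by (cases k) (auto simp: r_def)
  moreover have "of_nat (Suc k) * r (w @ j # replicate k a) = r (w @ [j])" if "j \<noteq> a" for w j k
  proof (cases "w = [] \<and> j = b")
    case True
    then show ?thesis using r_W[of k] r_W[of 0] by (simp del: of_nat_Suc)
  next
    case False
    have "w @ j # replicate l a \<notin> ?W" for l
    proof
      assume "w @ j # replicate l a \<in> ?W"
      then obtain k where k: "w @ j # replicate l a = b # replicate k a" by auto
      with False obtain v where "w = b # v" by (cases w) auto
      with k have "j \<in> set (replicate k a)"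
        by (metis append_Cons in_set_conv_decomp list.inject)
      with that show False by simp
    qed
    from this[of k] this[of 0] show ?thesis by (simp add: r_def)
  qed
  ultimately have "Abs_ell2 r \<in> harmonic_subspace a"
    by (auto simp: harmonic_subspace_def coord_r)
  moreover have "Abs_ell2 r \<noteq> 0"
  proof
    assume "Abs_ell2 r = 0"
    then have "r [b] = 0" using fun_cong[OF coord_r, of "[b]"] by (simp add: zero_ell2.rep_eq)
    then show False using r_W[of 0] by simp
  qed
  ultimately show ?thesis by blast
qed

section \<open>Unboundedness\<close>

text \<open>
  The product of \<open>\<Sum> z\<^sup>k/(k+1)\<close> and \<open>1 + z + z\<^sup>2 + \<dots>\<close> has the harmonic numbers as its coefficients;
  cutting off the second factor at \<open>N\<close> does not change the coefficients below \<open>N\<close>.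
\<close>

lemma nc_toeplitz_coord_sum_powers:
  assumes T: "T \<in> nc_toeplitz" "blinfun_apply T (\<xi> []) \<in> harmonic_subspace a"
    and "j \<noteq> a" "m < N"
  shows "coord (blinfun_apply T (\<Sum>k<N. \<xi> (replicate k a))) (w @ j # replicate m a)
    = of_real (harm (Suc m)) * coord (blinfun_apply T (\<xi> [])) (w @ [j])"
proof -
  let ?h = "coord (blinfun_apply T (\<xi> []))"
  have h: "?h (w @ j # replicate l a) = ?h (w @ [j]) / of_nat (Suc l)" for l
  proof -
    have "of_nat (Suc l) * ?h (w @ j # replicate l a) = ?h (w @ [j])"
      using T(2) \<open>j \<noteq> a\<close> unfolding harmonic_subspace_def by blast
    then show ?thesis by (simp add: field_simps del: of_nat_Suc)
  qed
  have "coord (blinfun_apply T (\<Sum>k<N. \<xi> (replicate k a))) (w @ j # replicate m a)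
      = (\<Sum>k<N. if k \<le> m then ?h (w @ j # replicate (m - k) a) else 0)"
    by (simp add: blinfun.sum_right coord_sum nc_toeplitz_basis_vec_coord[OF T(1) \<open>j \<noteq> a\<close>])
  also have "\<dots> = (\<Sum>k\<le>m. ?h (w @ j # replicate (m - k) a))"
    using \<open>m < N\<close> by (intro sum.mono_neutral_cong_right) auto
  also have "\<dots> = (\<Sum>l\<le>m. ?h (w @ j # replicate l a))"
    using sum.nat_diff_reindex[of "\<lambda>l. ?h (w @ j # replicate l a)" "Suc m"]
    by (simp add: lessThan_Suc_atMost)
  also have "\<dots> = (\<Sum>l\<le>m. of_real (inverse (of_nat (Suc l)))) * ?h (w @ [j])"
    unfolding h by (simp add: sum_distrib_right divide_inverse mult.commute del: of_nat_Suc)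
  also have "(\<Sum>l\<le>m. of_real (inverse (of_nat (Suc l)))) = complex_of_real (harm (Suc m))"
    by (simp add: harm_altdef lessThan_Suc_atMost del: of_nat_Suc)
  finally show ?thesis .
qed

text \<open>
  For \<open>N = 2K\<close>, the \<open>K\<close> coordinates with index \<open>m\<close> in the upper half of the range are all at least
  \<open>harm K\<close> times \<open>\<bar>h\<^bsub>wj\<^esub>\<bar>\<close> in modulus, where \<open>h = T \<xi>\<^sub>1\<close>. Their squares add up to at least \<open>K\<close> times
  the square of that number, while the square of the norm of the argument is \<open>2K\<close>. Thus \<open>K\<close>
  cancels and leaves a bound by the operator norm.
\<close>

lemma nc_toeplitz_harmonic_bound:
  assumes T: "T \<in> nc_toeplitz" "blinfun_apply T (\<xi> []) \<in> harmonic_subspace a"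
    and "j \<noteq> a" "K > 0"
  shows "harm K * cmod (coord (blinfun_apply T (\<xi> [])) (w @ [j])) \<le> 2 * norm T"
proof -
  let ?g = "\<Sum>k<2*K. \<xi> (replicate k a)"
  let ?h = "cmod (coord (blinfun_apply T (\<xi> [])) (w @ [j]))"
  let ?word = "\<lambda>m. w @ j # replicate m a"
  have inj: "inj_on (\<lambda>m. replicate m a) A" "inj_on ?word A" for A
    by (auto simp: inj_on_def)
  have "real K * (harm K * ?h)\<^sup>2 = (\<Sum>m=K..<2*K. (harm K * ?h)\<^sup>2)"
    by simp
  also have "\<dots> \<le> (\<Sum>m=K..<2*K. (cmod (coord (blinfun_apply T ?g) (?word m)))\<^sup>2)"
  proof (rule sum_mono)
    fix m assume "m \<in> {K..<2*K}"
    then have "cmod (coord (blinfun_apply T ?g) (?word m)) = harm (Suc m) * ?h"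
      by (subst nc_toeplitz_coord_sum_powers[OF T \<open>j \<noteq> a\<close>])
        (auto simp: norm_mult harm_nonneg)
    moreover have "(harm K :: real) \<le> harm (Suc m)"
      using \<open>m \<in> _\<close> by (intro harm_mono) auto
    ultimately show "(harm K * ?h)\<^sup>2 \<le> (cmod (coord (blinfun_apply T ?g) (?word m)))\<^sup>2"
      by (auto intro!: power_mono mult_right_mono simp: harm_nonneg)
  qed
  also have "\<dots> = (\<Sum>v\<in>?word ` {K..<2*K}. (cmod (coord (blinfun_apply T ?g) v))\<^sup>2)"
    by (subst sum.reindex[OF inj(2)]) simp
  also have "\<dots> \<le> (norm (blinfun_apply T ?g))\<^sup>2"
    by (rule sum_coord_square_le_norm_square) simp
  also have "\<dots> \<le> (norm T * norm ?g)\<^sup>2"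
    by (intro power_mono norm_blinfun) simp
  also have "\<dots> = (norm T)\<^sup>2 * (2 * real K)"
    by (simp add: power_mult_distrib norm_sum_basis_vec_square[OF inj(1)])
  finally have "(harm K * ?h)\<^sup>2 \<le> 2 * (norm T)\<^sup>2"
    using \<open>K > 0\<close> by simp
  also have "\<dots> \<le> (2 * norm T)\<^sup>2"
    by (simp add: power_mult_distrib)
  finally show ?thesis
    by (rule power2_le_imp_le) simp
qed

lemma left_ideal_harmonic_subspace: "left_ideal (harmonic_subspace a) = {0}"
proof (intro equalityI subsetI)
  fix T assume "T \<in> left_ideal (harmonic_subspace a)"
  then have T: "T \<in> nc_toeplitz" "blinfun_apply T (\<xi> []) \<in> harmonic_subspace a"
    by (auto simp: left_ideal_def)
  let ?h = "coord (blinfun_apply T (\<xi> []))"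
  have letter: "?h (w @ [j]) = 0" if "j \<noteq> a" for w j
  proof (rule ccontr)
    assume "?h (w @ [j]) \<noteq> 0"
    then have "harm K \<le> 2 * norm T / cmod (?h (w @ [j]))" if "K > 0" for K
      using nc_toeplitz_harmonic_bound[OF T \<open>j \<noteq> a\<close> that, of w] by (simp add: field_simps)
    moreover have "\<forall>\<^sub>F K in sequentially. 2 * norm T / cmod (?h (w @ [j])) < harm K"
      using harm_at_top by (simp add: filterlim_at_top_dense)
    then obtain K where "2 * norm T / cmod (?h (w @ [j])) < harm (Suc K)"
      unfolding eventually_sequentially by (meson le_SucI order_refl)
    ultimately show False by (meson not_le zero_less_Suc)
  qed
  \<comment> \<open>Every word is \<open>w j a\<^sup>k\<close> with \<open>j \<noteq> a\<close>, or a power of \<open>a\<close>.\<close>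
  have "?h v = 0" for v
  proof (cases "\<exists>w j k. v = w @ j # replicate k a \<and> j \<noteq> a")
    case True
    then obtain w j k where v: "v = w @ j # replicate k a" "j \<noteq> a" by blast
    have "of_nat (Suc k) * ?h v = ?h (w @ [j])"
      using T(2) v unfolding harmonic_subspace_def by blast
    then show ?thesis using letter[OF v(2)] by (simp del: of_nat_Suc)
  next
    case False
    have "v = replicate (length v) a"
    proof (rule ccontr)
      assume "v \<noteq> replicate (length v) a"
      then have "\<exists>j\<in>set v. j \<noteq> a" by (metis replicate_length_same)
      then obtain w j u where "v = w @ j # u" "j \<noteq> a" "\<forall>i\<in>set u. i = a"
        using split_list_last_prop[of v "\<lambda>j. j \<noteq> a"] by blast
      with False show False by (metis replicate_length_same)
    qed
    then show ?thesis
      using T(2) by (metis (mono_tags, lifting) harmonic_subspace_def mem_Collect_eq)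
  qed
  then have "blinfun_apply T (\<xi> []) = 0"
    by (intro ell2_eqI) (simp add: zero_ell2.rep_eq)
  then show "T \<in> {0}" using nc_toeplitz_eq_0[OF T(1)] by simp
next
  fix T :: "'a list ell2 \<Rightarrow>\<^sub>L 'a list ell2" assume "T \<in> {0}"
  then show "T \<in> left_ideal (harmonic_subspace a)"
    using ell2.subspace_0[OF harmonic_subspace_subspace]
    by (simp add: left_ideal_def zero_in_nc_toeplitz)
qed

theorem theorem3p7:
  assumes "CARD('n::finite) \<ge> 2"
  shows "\<exists>M \<in> Lat (nc_toeplitz :: ('n list ell2 \<Rightarrow>\<^sub>L 'n list ell2) set).
           M \<noteq> {0} \<and> left_ideal M = {0}"
proof -
  have "\<not> (\<forall>a\<in>UNIV. \<forall>b\<in>UNIV. a = (b :: 'n))"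
    using assms by (subst card_le_Suc0_iff_eq[symmetric]) simp_all
  then obtain a b :: 'n where "b \<noteq> a" by blast
  show ?thesis
  proof (intro bexI conjI)
    show "harmonic_subspace a \<noteq> {0}"
      using \<open>b \<noteq> a\<close> by (rule harmonic_subspace_nontrivial)
    show "left_ideal (harmonic_subspace a) = {0}"
      by (rule left_ideal_harmonic_subspace)
    show "harmonic_subspace a \<in> Lat nc_toeplitz"
      by (rule harmonic_subspace_in_Lat)
  qed
qed

end
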